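(* Let $X$ be a finite simplicial complex on vertex set $V$ with $|V|=n$, and suppose $h(X)=d$, i.e. the maximal dimension of a missing face of $X$ is $d$. Let $k\ge d-1$ be an integer. If $$\mu_{d-1}(X)>\left(1-\binom{k+1}{d}^{-1}\right)n,$$ then $\tilde H^j(X;\mathbb{R})=0$ for all $d-1\le j\le k$.
   Context: A finite simplicial complex $X$ on a finite vertex set $V$ is a downward closed family of subsets of $V$ containing $\emptyset$ and every singleton $\{v\}$, $v\in V$; the dimension of a set $\sigma$ is $|\sigma|-1$, and $X(k)$ denotes the set of $k$-dimensional simplices of $X$. A set $\sigma\subset V$ is a missing face of $X$ if $\sigma\notin X$ but every proper subset of $\sigma$ belongs to $X$. $h(X)$ is the maximum of $\dim(\sigma)$ over all missing faces $\sigma$ of $X$ (so saying $h(X)=d$ presupposes that $X$ has a missing face, and $d\ge 1$). For $k\ge 0$, $C^k(X)$ is the real vector space of skew-symmetric real functions on ordered $k$-simplices of $X$, and $C^{-1}(X)=\mathbb{R}$. The coboundary $d_k:C^k(X)\to C^{k+1}(X)$ is $d_k\phi([v_0,\dots,v_{k+1}])=\sum_{i=0}^{k+1}(-1)^i\phi([v_0,\dots,\widehat{v_i},\dots,v_{k+1}])$ for $k\ge0$, and $(d_{-1}a)(v)=a$ for $a\in\mathbb{R}$, $v\in V$. $\tilde H^k(X;\mathbb R)=\ker d_k/\operatorname{Im} d_{k-1}$ is the reduced cohomology. $C^k(X)$ carries the inner product $\langle\phi,\psi\rangle=\sum_{\sigma\in X(k)}\phi(\sigma)\psi(\sigma)$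 (one fixed ordering chosen for each simplex; on $C^{-1}(X)=\mathbb R$ the usual product), and $d_k^*$ is the adjoint of $d_k$. For $k\ge 0$ the reduced $k$-Laplacian is $L_k(X)=d_{k-1}d_{k-1}^*+d_k^*d_k:C^k(X)\to C^k(X)$, a positive semidefinite operator, and $\mu_k(X)$ is its smallest eigenvalue. *)

theory Defs
  imports
    Complex_Main
    "HOL-Combinatorics.Permutations"
    "HOL-Algebra.Coset"
    "HOL-Algebra.Elementary_Groups"
begin

definition simplicial_complex :: "'a set \<Rightarrow> 'a set set \<Rightarrow> bool" where
  "simplicial_complex V X \<longleftrightarrow>
     finite V \<and> (\<forall>\<sigma>\<in>X. \<sigma> \<subseteq> V) \<and> (\<forall>\<sigma>\<in>X. \<forall>\<tau>. \<tau> \<subseteq> \<sigma> \<longrightarrow> \<tau> \<in> X) \<and>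
     {} \<in> X \<and> (\<forall>v\<in>V. {v} \<in> X)"

text \<open>Dimensions are integers, so that the empty simplex has dimension \<open>-1\<close>.\<close>

definition simplex_dim :: "'a set \<Rightarrow> int" where
  "simplex_dim \<sigma> = int (card \<sigma>) - 1"

definition simplices :: "'a set set \<Rightarrow> int \<Rightarrow> 'a set set" where
  "simplices X k = {\<sigma> \<in> X. simplex_dim \<sigma> = k}"

definition missing_faces :: "'a set \<Rightarrow> 'a set set \<Rightarrow> 'a set set" where
  "missing_faces V X = {\<sigma>. \<sigma> \<subseteq> V \<and> \<sigma> \<notin> X \<and> (\<forall>\<tau>. \<tau> \<subset> \<sigma> \<longrightarrow> \<tau> \<in> X)}"

text \<open>Only meaningful if there is a missing face, since \<open>Max {}\<close> is unspecified.\<close>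

definition max_missing_dim :: "'a set \<Rightarrow> 'a set set \<Rightarrow> int" where
  "max_missing_dim V X = Max (simplex_dim ` missing_faces V X)"

definition ordered_simplices :: "'a set set \<Rightarrow> int \<Rightarrow> 'a list set" where
  "ordered_simplices X k = {xs. distinct xs \<and> set xs \<in> simplices X k}"

text \<open>
  A cochain is a function on lists that vanishes off the ordered simplices, which makes equality
  of cochains equality of functions.  The only ordered \<open>(-1)\<close>-simplex is \<open>[]\<close>, so the cochains of
  degree \<open>-1\<close> are the real numbers (the values at \<open>[]\<close>).
\<close>

definition cochains :: "'a set set \<Rightarrow> int \<Rightarrow> ('a list \<Rightarrow> real) set" where
  "cochains X k = {\<phi>.
     (\<forall>xs. xs \<notin> ordered_simplices X k \<longrightarrow> \<phi> xs = 0) \<and>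
     (\<forall>xs\<in>ordered_simplices X k. \<forall>p. p permutes {..<length xs} \<longrightarrow>
        \<phi> (permute_list p xs) = of_int (sign p) * \<phi> xs)}"

text \<open>For \<open>k = -1\<close> this gives the function with constant value \<open>\<phi> []\<close> on the vertices.\<close>

definition coboundary :: "'a set set \<Rightarrow> int \<Rightarrow> ('a list \<Rightarrow> real) \<Rightarrow> 'a list \<Rightarrow> real" where
  "coboundary X k \<phi> = (\<lambda>xs.
     if xs \<in> ordered_simplices X (k + 1)
     then \<Sum>i<length xs. (-1) ^ i * \<phi> (take i xs @ drop (Suc i) xs)
     else 0)"

definition chosen_ordering :: "'a set \<Rightarrow> 'a list" where
  "chosen_ordering \<sigma> = (SOME xs. distinct xs \<and> set xs = \<sigma>)"

definition cochain_inner ::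
    "'a set set \<Rightarrow> int \<Rightarrow> ('a list \<Rightarrow> real) \<Rightarrow> ('a list \<Rightarrow> real) \<Rightarrow> real" where
  "cochain_inner X k \<phi> \<psi> =
     (\<Sum>\<sigma>\<in>simplices X k. \<phi> (chosen_ordering \<sigma>) * \<psi> (chosen_ordering \<sigma>))"

text \<open>
  The adjoint of \<open>coboundary X k\<close> with respect to these inner products.  It exists and is unique
  for finite \<open>X\<close>, the spaces of cochains being finite-dimensional.
\<close>

definition coboundary_adj :: "'a set set \<Rightarrow> int \<Rightarrow> ('a list \<Rightarrow> real) \<Rightarrow> 'a list \<Rightarrow> real" where
  "coboundary_adj X k \<psi> = (THE \<phi>. \<phi> \<in> cochains X k \<and>
     (\<forall>\<chi>\<in>cochains X k.
        cochain_inner X (k + 1) (coboundary X k \<chi>) \<psi> = cochain_inner X k \<chi> \<phi>))"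

definition laplacian :: "'a set set \<Rightarrow> int \<Rightarrow> ('a list \<Rightarrow> real) \<Rightarrow> 'a list \<Rightarrow> real" where
  "laplacian X k \<phi> = (\<lambda>xs.
     coboundary X (k - 1) (coboundary_adj X (k - 1) \<phi>) xs +
     coboundary_adj X k (coboundary X k \<phi>) xs)"

definition laplacian_eigenvalue :: "'a set set \<Rightarrow> int \<Rightarrow> real \<Rightarrow> bool" where
  "laplacian_eigenvalue X k l \<longleftrightarrow>
     (\<exists>\<phi>\<in>cochains X k. \<phi> \<noteq> (\<lambda>_. 0) \<and> laplacian X k \<phi> = (\<lambda>xs. l * \<phi> xs))"

definition min_eigenvalue :: "'a set set \<Rightarrow> int \<Rightarrow> real" where
  "min_eigenvalue X k = (LEAST l. laplacian_eigenvalue X k l)"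

definition cochain_group :: "'a set set \<Rightarrow> int \<Rightarrow> ('a list \<Rightarrow> real) monoid" where
  "cochain_group X k =
     \<lparr>carrier = cochains X k, mult = (\<lambda>\<phi> \<psi> xs. \<phi> xs + \<psi> xs), one = (\<lambda>_. 0)\<rparr>"

text \<open>
  The quotient of kernel by image, as an (additive) abelian group: its elements are the cosets of
  the image.  Scalar multiplication is not recorded; the quotient vector space is zero iff this
  group is trivial.
\<close>

definition reduced_cohomology :: "'a set set \<Rightarrow> int \<Rightarrow> ('a list \<Rightarrow> real) set monoid" where
  "reduced_cohomology X k =
     (cochain_group X k)
       \<lparr>carrier := kernel (cochain_group X k) (cochain_group X (k + 1)) (coboundary X k)\<rparr>
     Mod (coboundary X (k - 1) ` cochains X (k - 1))"

end

theory Submission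
  imports Defs "HOL-Combinatorics.Multiset_Permutations" "HOL-Analysis.Function_Topology"
begin

text \<open>
  Let \<open>n\<close> be the number of vertices. In the full simplex on \<open>V\<close> every Laplacian is \<open>n\<close> times the
  identity, so extending a cochain \<open>\<phi>\<close> of \<open>X\<close> by zero and taking its coboundary there gives
  \<open>\<langle>L \<phi>, \<phi>\<rangle> = n \<parallel>\<phi>\<parallel>\<^sup>2 - D(\<phi>)\<close>, where the defect \<open>D(\<phi>)\<close> is the squared norm of the part of this
  coboundary that sits on non-faces of \<open>X\<close> (\<open>dot_lap_self\<close>). A lower bound for the Laplacian is
  thus an upper bound for the defect.

  Upper bounds for the defect pass to higher degrees by contracting with a vertex. Write
  \<open>\<phi>\<^sub>u = \<phi>(u, \<dots>)\<close>. If \<open>\<pi>\<close> is a non-face, then so is \<open>u \<pi>\<close>, and the full coboundaries of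
  \<open>\<phi>\<^sub>u\<close> at \<open>\<pi>\<close> and of \<open>\<phi>\<close> at \<open>u \<pi>\<close> agree up to sign. Hence the sum of the \<open>D(\<phi>\<^sub>u)\<close> counts the
  value of the coboundary of \<open>\<phi>\<close> at a non-face \<open>\<rho>\<close> once for every \<open>u \<in> \<rho>\<close> such that
  \<open>\<rho> - {u}\<close> is still a non-face. As \<open>\<rho>\<close> contains a missing face, which has at most \<open>d + 1\<close> vertices,
  every vertex of \<open>\<rho>\<close> outside it will do, so every non-face with \<open>k + 2\<close> vertices is counted at
  least \<open>k + 1 - d\<close> times (\<open>defect_link_bound\<close>). On the other hand the \<open>\<parallel>\<phi>\<^sub>u\<parallel>\<^sup>2\<close> add up to
  \<open>(k + 1) \<parallel>\<phi>\<parallel>\<^sup>2\<close>. Iterating from degree \<open>d - 1\<close> to degree \<open>k\<close> multiplies the bound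
  \<open>n - \<mu>\<close>, with \<open>\<mu>\<close> the smallest eigenvalue in degree \<open>d - 1\<close>, by the product of the factors
  \<open>(i + 1) / (i + 1 - d)\<close> for \<open>d \<le> i \<le> k\<close>, which is \<open>(k + 1) choose d\<close>
  (\<open>defect_bound_all_degrees\<close>). The hypothesis on \<open>\<mu>\<close> says that the result is less than \<open>n\<close>, so the
  Laplacian is positive definite in all degrees from \<open>d - 1\<close> to \<open>k\<close>.

  A positive definite Laplacian has no cohomology: it is surjective, and if \<open>L \<chi>\<close> is a
  cocycle, then its component in the image of the adjoint coboundary vanishes, so that it is a
  coboundary (\<open>cocycle_is_coboundary\<close>). The two facts of linear algebra behind this, that the least
  eigenvalue is the minimum of the Rayleigh quotient and that a coercive operator is surjective, are
  obtained by minimizing quadratic functions over compact sets (\<open>ex_least_eigenvalue\<close>,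
  \<open>coercive_imp_surjective\<close>).
\<close>

section \<open>Alternating functions on lists\<close>

text \<open>
  Antisymmetry under adjacent transpositions alone: this form is easy to establish by induction on
  lists, and \<open>alternating_permute_list\<close> recovers the behaviour under all permutations.
\<close>
definition alternating :: "('a list \<Rightarrow> real) \<Rightarrow> bool" where
  "alternating f \<longleftrightarrow> (\<forall>as x y bs. f (as @ x # y # bs) = - f (as @ y # x # bs))"

lemma alternatingD: "alternating f \<Longrightarrow> f (as @ x # y # bs) = - f (as @ y # x # bs)"
  unfolding alternating_def by blast

lemma alternating_Cons: "alternating f \<Longrightarrow> alternating (\<lambda>zs. f (u # zs))"
  unfolding alternating_def by (metis append_Cons)

lemma alternating_insert:
  assumes "alternating f"
  shows "f (as @ bs @ u # cs) = (-1) ^ length bs * f (as @ u # bs @ cs)"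
proof (induction bs arbitrary: as)
  case (Cons b bs)
  have "f (as @ (b # bs) @ u # cs) = (-1) ^ length bs * f (as @ b # u # bs @ cs)"
    using Cons[of "as @ [b]"] by simp
  also have "f (as @ b # u # bs @ cs) = - f (as @ u # b # bs @ cs)"
    by (rule alternatingD[OF assms])
  also have "(-1) ^ length bs * - f (as @ u # b # bs @ cs)
      = (-1) ^ length (b # bs) * f (as @ u # (b # bs) @ cs)"
    by simp
  finally show ?case .
qed simp

lemma alternating_not_distinct:
  assumes "alternating f" "\<not> distinct xs"
  shows "f xs = 0"
proof -
  obtain as bs cs x where xs: "xs = as @ [x] @ bs @ [x] @ cs"
    using not_distinct_decomp[OF assms(2)] by blast
  have "f xs = (-1) ^ length bs * f (as @ x # x # bs @ cs)"
    using alternating_insert[OF assms(1), of "as @ [x]" bs x cs] xs by simp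
  moreover have "f (as @ x # x # bs @ cs) = 0"
    using alternatingD[OF assms(1), of as x x "bs @ cs"] by simp
  ultimately show ?thesis by simp
qed

text \<open>Moving \<open>y\<close> to the front of \<open>bs\<close> and \<open>x\<close> back to its end costs the same sign twice; between
  the two moves there is one adjacent transposition.\<close>
lemma alternating_exchange:
  assumes "alternating f"
  shows "f (as @ x # bs @ y # cs) = - f (as @ y # bs @ x # cs)"
proof -
  have "f (as @ x # bs @ y # cs) = (-1) ^ length bs * f (as @ x # y # bs @ cs)"
    using alternating_insert[OF assms, of "as @ [x]" bs y cs] by simp
  also have "f (as @ x # y # bs @ cs) = - f (as @ y # x # bs @ cs)"
    by (rule alternatingD[OF assms])
  also have "(-1) ^ length bs * - f (as @ y # x # bs @ cs) = - f (as @ y # bs @ x # cs)"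
    using alternating_insert[OF assms, of "as @ [y]" bs x cs] by simp
  finally show ?thesis .
qed

lemma permute_list_transpose:
  assumes "a < length xs" "b < length xs"
  shows "permute_list (Transposition.transpose a b) xs = xs[a := xs ! b, b := xs ! a]"
  using assms
  by (intro nth_equalityI)
     (simp_all add: permute_list_def nth_list_update Transposition.transpose_def)

lemma alternating_transpose:
  assumes "alternating f" "a < b" "b < length xs"
  shows "f (permute_list (Transposition.transpose a b) xs) = - f xs"
proof -
  define as bs cs where "as = take a xs" and "bs = drop (Suc a) (take b xs)"
    and "cs = drop (Suc b) xs"
  have "xs = take b xs @ xs ! b # cs"
    using assms by (simp add: cs_def id_take_nth_drop)
  moreover have "take b xs = as @ xs ! a # bs"
    using assms id_take_nth_drop[of a "take b xs"] by (simp add: as_def bs_def min_def)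
  ultimately have xs: "xs = as @ xs ! a # bs @ xs ! b # cs"
    by (metis append.assoc append_Cons)
  have a: "a = length as" and b: "b = length as + Suc (length bs)"
    using assms by (simp_all add: as_def bs_def)
  have upd: "(as @ u # bs @ v # cs)[a := v, b := u] = as @ v # bs @ u # cs" for u v
    by (simp add: a b list_update_append)
  have "xs[a := xs ! b, b := xs ! a] = as @ xs ! b # bs @ xs ! a # cs"
    using upd[of "xs ! a" "xs ! b"] xs by metis
  then have "f (permute_list (Transposition.transpose a b) xs) = f (as @ xs ! b # bs @ xs ! a # cs)"
    using assms by (simp add: permute_list_transpose)
  also have "\<dots> = - f (as @ xs ! a # bs @ xs ! b # cs)"
    by (rule alternating_exchange[OF assms(1)])
  finally show ?thesis using xs by metis
qed

lemma alternating_permute_list: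
  assumes "alternating f" "p permutes {..<length xs}"
  shows "f (permute_list p xs) = of_int (sign p) * f xs"
proof -
  have "\<forall>xs. length xs = n \<longrightarrow> f (permute_list p xs) = of_int (sign p) * f xs"
    if "p permutes {..<n}" for n :: nat
    using that finite_lessThan
  proof (induction p rule: permutes_induct)
    case (swap a b p)
    have ab: "f (permute_list (Transposition.transpose a b) ys) = - f ys" if "length ys = n"
      for ys :: "'a list"
    proof (cases "a < b")
      case True
      then show ?thesis using alternating_transpose[OF assms(1), of a b ys] swap.hyps that by simp
    next
      case False
      then show ?thesis using alternating_transpose[OF assms(1), of b a ys] swap.hyps that by (simp add: transpose_commute)
    qed
    have "sign (Transposition.transpose a b \<circ> p) = - sign p"
      using swap.hyps permutes_imp_permutation[OF finite_lessThan \<open>p permutes _\<close>]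
      by (simp add: sign_compose sign_swap_id permutation_swap_id)
    moreover have "permute_list (Transposition.transpose a b \<circ> p) ys
        = permute_list p (permute_list (Transposition.transpose a b) ys)" if "length ys = n"
      for ys :: "'a list"
      using \<open>p permutes _\<close> that by (intro permute_list_compose) simp
    ultimately show ?case
      using swap.IH ab by (metis (no_types, lifting) length_permute_list mult_minus_left mult_minus_right of_int_minus)
  qed simp
  with assms(2) show ?thesis by blast
qed


section \<open>The coboundary of the full simplex\<close>

text \<open>
  Expanding the alternating sum over the deleted positions along the first one turns the identities
  of this section into inductions on the list; \<open>face_sum_eq_sum\<close> gives the closed form.
\<close>
fun face_sum :: "('a list \<Rightarrow> real) \<Rightarrow> 'a list \<Rightarrow> real" where
  "face_sum f [] = 0"
| "face_sum f (x # xs) = f xs - face_sum (\<lambda>zs. f (x # zs)) xs"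

lemma face_sum_eq_sum:
  "face_sum f xs = (\<Sum>i<length xs. (-1) ^ i * f (take i xs @ drop (Suc i) xs))"
  by (induction xs arbitrary: f) (simp_all add: sum.lessThan_Suc_shift sum_negf del: sum.lessThan_Suc)

lemma face_sum_linear:
  "face_sum (\<lambda>xs. f xs + t * g xs) xs = face_sum f xs + t * face_sum g xs"
  by (induction xs arbitrary: f g) (simp_all add: algebra_simps)

lemma face_sum_zero [simp]: "face_sum (\<lambda>_. 0) xs = 0"
  by (induction xs) simp_all

lemma face_sum_diff: "face_sum (\<lambda>xs. f xs - g xs) xs = face_sum f xs - face_sum g xs"
  using face_sum_linear[of f "-1" g xs] by simp

lemma face_sum_uminus: "face_sum (\<lambda>xs. - g xs) xs = - face_sum g xs"
  using face_sum_diff[of "\<lambda>_. 0" g xs] by simp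

lemma face_sum_face_sum: "face_sum (face_sum f) xs = 0"
  by (induction xs arbitrary: f) (simp_all add: face_sum_diff)

lemma alternating_face_sum:
  assumes "alternating f"
  shows "alternating (face_sum f)"
proof -
  have "face_sum f (as @ x # y # bs) = - face_sum f (as @ y # x # bs)" if "alternating f"
    for as x y bs and f :: "'a list \<Rightarrow> real"
    using that
  proof (induction as arbitrary: f)
    case Nil
    have "(\<lambda>zs. f (x # y # zs)) = (\<lambda>zs. - f (y # x # zs))"
      using alternatingD[OF Nil, of "[]" x y] by (intro ext) (simp only: append_Nil)
    then have "face_sum (\<lambda>zs. f (x # y # zs)) bs = - face_sum (\<lambda>zs. f (y # x # zs)) bs"
      by (simp add: face_sum_uminus)
    then show ?case by simp
  next
    case (Cons a as)
    then show ?case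
      using Cons.IH[OF alternating_Cons[OF Cons.prems, of a]]
        alternatingD[OF Cons.prems, of as x y bs] by simp
  qed
  with assms show ?thesis unfolding alternating_def by blast
qed

lemma continuous_on_face_sum:
  assumes "\<And>zs. continuous_on A (\<lambda>x. g x zs)"
  shows "continuous_on A (\<lambda>x. face_sum (g x) xs)"
  using assms by (induction xs arbitrary: g) (auto intro!: continuous_intros)


locale finite_complex =
  fixes V :: "'a set" and X :: "'a set set"
  assumes complex: "simplicial_complex V X"
begin

lemma finite_V: "finite V"
  and simplex_subset: "\<sigma> \<in> X \<Longrightarrow> \<sigma> \<subseteq> V"
  and face_closed: "\<sigma> \<in> X \<Longrightarrow> \<tau> \<subseteq> \<sigma> \<Longrightarrow> \<tau> \<in> X"
  using complex by (auto simp: simplicial_complex_def)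

lemma finite_X: "finite X"
  using finite_V simplex_subset by (meson Pow_iff finite_Pow_iff finite_subset subsetI)

section \<open>Sums over tuples of vertices\<close>

definition tuples :: "nat \<Rightarrow> 'a list set" where
  "tuples m = {xs. set xs \<subseteq> V \<and> length xs = m}"

text \<open>
  Summing over all tuples instead of one ordering per simplex makes each sum splittable along
  coordinates. For cochains it multiplies the inner product by the number of orderings of a
  simplex, see \<open>dot_eq_cochain_inner\<close>.
\<close>
definition dot :: "nat \<Rightarrow> ('a list \<Rightarrow> real) \<Rightarrow> ('a list \<Rightarrow> real) \<Rightarrow> real" where
  "dot m f g = (\<Sum>xs\<in>tuples m. f xs * g xs)"

text \<open>The adjoint of the coboundary, up to the normalization of \<open>dot\<close>: see \<open>dot_face_sum\<close> and
  \<open>coboundary_adj_eq_codiff\<close>.\<close>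
definition codiff :: "('a list \<Rightarrow> real) \<Rightarrow> 'a list \<Rightarrow> real" where
  "codiff \<psi> xs = (\<Sum>u\<in>V. \<psi> (u # xs))"

lemma finite_tuples: "finite (tuples m)"
  unfolding tuples_def by (rule finite_lists_length_eq[OF finite_V])

lemma dot_commute: "dot m f g = dot m g f"
  by (simp add: dot_def mult.commute)

lemma dot_nonneg: "0 \<le> dot m f f"
  by (simp add: dot_def sum_nonneg)

lemma dot_eq_0_iff: "dot m f f = 0 \<longleftrightarrow> (\<forall>xs\<in>tuples m. f xs = 0)"
  by (simp add: dot_def sum_nonneg_eq_0_iff finite_tuples)

lemma sum_tuples_Suc:
  "(\<Sum>ys\<in>tuples (Suc m). f ys) = (\<Sum>u\<in>V. \<Sum>xs\<in>tuples m. f (u # xs))"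
proof -
  have "tuples (Suc m) = (\<lambda>(u, xs). u # xs) ` (V \<times> tuples m)"
    by (auto simp: tuples_def length_Suc_conv image_iff)
  moreover have "inj_on (\<lambda>(u, xs). u # xs) (V \<times> tuples m)"
    by (auto simp: inj_on_def)
  ultimately have "(\<Sum>ys\<in>tuples (Suc m). f ys) = (\<Sum>(u, xs)\<in>V \<times> tuples m. f (u # xs))"
    by (simp add: sum.reindex case_prod_unfold)
  then show ?thesis by (simp add: sum.cartesian_product)
qed

lemma sum_tuples_insert:
  assumes "i \<le> m"
  shows "(\<Sum>ys\<in>tuples (Suc m). f ys)
       = (\<Sum>u\<in>V. \<Sum>xs\<in>tuples m. f (take i xs @ u # drop i xs))"
proof -
  define g where "g = (\<lambda>ys. f (take i (tl ys) @ hd ys # drop i (tl ys)))"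
  have "(\<Sum>ys\<in>tuples (Suc m). f ys) = (\<Sum>ys\<in>tuples (Suc m). g ys)"
  proof (rule sum.reindex_bij_witness[
      where j = "\<lambda>ys. ys ! i # take i ys @ drop (Suc i) ys"
        and i = "\<lambda>ys. take i (tl ys) @ hd ys # drop i (tl ys)"])
    fix ys assume ys: "ys \<in> tuples (Suc m)"
    then have *: "take i ys @ ys ! i # drop (Suc i) ys = ys"
      using assms by (simp add: tuples_def flip: id_take_nth_drop)
    have i: "i < length ys" using ys assms by (simp add: tuples_def)
    show "take i (tl (ys ! i # take i ys @ drop (Suc i) ys)) @
        hd (ys ! i # take i ys @ drop (Suc i) ys) #
        drop i (tl (ys ! i # take i ys @ drop (Suc i) ys)) = ys"
      using i * by simp
    then show "g (ys ! i # take i ys @ drop (Suc i) ys) = f ys"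
      by (simp only: g_def)
    have "set (take i ys @ ys ! i # drop (Suc i) ys) \<subseteq> V"
      using ys * by (simp only:) (simp add: tuples_def)
    then show "ys ! i # take i ys @ drop (Suc i) ys \<in> tuples (Suc m)"
      using i ys by (auto simp: tuples_def)
  next
    fix ys assume ys: "ys \<in> tuples (Suc m)"
    then obtain u xs where [simp]: "ys = u # xs" and xs: "length xs = m" "set ys \<subseteq> V"
      by (auto simp: tuples_def length_Suc_conv)
    define zs where "zs = take i (tl ys) @ hd ys # drop i (tl ys)"
    have "zs ! i = u" "take i zs = take i xs" "drop (Suc i) zs = drop i xs"
      using xs assms by (simp_all add: zs_def nth_append)
    then show "zs ! i # take i zs @ drop (Suc i) zs = ys" by simp
    have "set (take i xs @ drop i xs) \<subseteq> V" using xs by simp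
    then show "zs \<in> tuples (Suc m)"
      using xs assms by (auto simp: tuples_def zs_def dest: in_set_takeD in_set_dropD)
  qed
  then show ?thesis by (simp add: sum_tuples_Suc g_def)
qed

text \<open>
  Each of the \<open>m + 1\<close> terms of the coboundary contributes equally: the entry that the \<open>i\<close>-th
  term deletes can be moved to the front of the argument of \<open>\<psi>\<close>, and the sign of this move
  cancels the sign of the term.
\<close>
lemma dot_face_sum:
  assumes "alternating \<psi>"
  shows "dot (Suc m) (face_sum \<chi>) \<psi> = real (Suc m) * dot m \<chi> (codiff \<psi>)"
proof -
  have "(\<Sum>ys\<in>tuples (Suc m). (-1) ^ i * \<chi> (take i ys @ drop (Suc i) ys) * \<psi> ys)
      = dot m \<chi> (codiff \<psi>)" if "i < Suc m" for i
  proof -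
    have "(\<Sum>ys\<in>tuples (Suc m). (-1) ^ i * \<chi> (take i ys @ drop (Suc i) ys) * \<psi> ys)
      = (\<Sum>u\<in>V. \<Sum>xs\<in>tuples m. (-1) ^ i * \<chi> xs * \<psi> (take i xs @ u # drop i xs))"
      using that by (subst sum_tuples_insert[of i]) (auto simp: tuples_def intro!: sum.cong)
    also have "\<dots> = (\<Sum>u\<in>V. \<Sum>xs\<in>tuples m. \<chi> xs * \<psi> (u # xs))"
    proof (intro sum.cong refl)
      fix u xs assume "xs \<in> tuples m"
      then have "\<psi> (take i xs @ u # drop i xs) = (-1) ^ i * \<psi> (u # xs)"
        using alternating_insert[OF assms, of "[]" "take i xs" u "drop i xs"] that
        by (simp add: tuples_def)
      then show "(-1) ^ i * \<chi> xs * \<psi> (take i xs @ u # drop i xs) = \<chi> xs * \<psi> (u # xs)"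
        by (simp flip: power_mult_distrib)
    qed
    also have "\<dots> = dot m \<chi> (codiff \<psi>)"
      by (subst sum.swap) (simp add: dot_def codiff_def sum_distrib_left)
    finally show ?thesis .
  qed
  moreover have "dot (Suc m) (face_sum \<chi>) \<psi>
      = (\<Sum>i<Suc m. \<Sum>ys\<in>tuples (Suc m). (-1) ^ i * \<chi> (take i ys @ drop (Suc i) ys) * \<psi> ys)"
    by (subst sum.swap)
       (simp add: dot_def face_sum_eq_sum sum_distrib_right tuples_def del: sum.lessThan_Suc)
  ultimately show ?thesis by (simp del: sum.lessThan_Suc)
qed

text \<open>
  The Laplacian of the full simplex is multiplication by the number of vertices. The mixed terms are
  treated by applying adjointness a second time, to the contractions of \<open>\<phi>\<close> with the vertices.
\<close>
lemma dot_face_sum_self: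
  assumes "alternating \<phi>"
  shows "dot (Suc (Suc m)) (face_sum \<phi>) (face_sum \<phi>)
    = real (m + 2) *
      (real (card V) * dot (Suc m) \<phi> \<phi> - real (Suc m) * dot m (codiff \<phi>) (codiff \<phi>))"
proof -
  have "codiff (face_sum \<phi>) xs = real (card V) * \<phi> xs - (\<Sum>u\<in>V. face_sum (\<lambda>zs. \<phi> (u # zs)) xs)"
    for xs
    by (simp add: codiff_def sum_subtractf)
  then have "\<phi> xs * codiff (face_sum \<phi>) xs = real (card V) * (\<phi> xs * \<phi> xs)
      - (\<Sum>u\<in>V. \<phi> xs * face_sum (\<lambda>zs. \<phi> (u # zs)) xs)" for xs
    by (simp add: right_diff_distrib sum_distrib_left)
  then have "dot (Suc m) \<phi> (codiff (face_sum \<phi>)) = real (card V) * dot (Suc m) \<phi> \<phi>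
      - (\<Sum>xs\<in>tuples (Suc m). \<Sum>u\<in>V. \<phi> xs * face_sum (\<lambda>zs. \<phi> (u # zs)) xs)"
    by (simp add: dot_def sum_subtractf sum_distrib_left)
  also have "(\<Sum>xs\<in>tuples (Suc m). \<Sum>u\<in>V. \<phi> xs * face_sum (\<lambda>zs. \<phi> (u # zs)) xs)
      = (\<Sum>u\<in>V. dot (Suc m) (face_sum (\<lambda>zs. \<phi> (u # zs))) \<phi>)"
    by (subst sum.swap) (simp add: dot_def mult.commute)
  also have "\<dots> = real (Suc m) * (\<Sum>u\<in>V. dot m (\<lambda>zs. \<phi> (u # zs)) (codiff \<phi>))"
    by (simp only: dot_face_sum[OF assms] sum_distrib_left)
  also have "(\<Sum>u\<in>V. dot m (\<lambda>zs. \<phi> (u # zs)) (codiff \<phi>)) = dot m (codiff \<phi>) (codiff \<phi>)"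
    unfolding dot_def by (subst sum.swap) (simp add: codiff_def sum_distrib_right)
  finally show ?thesis
    by (simp add: dot_face_sum[OF alternating_face_sum[OF assms]])
qed


section \<open>Cochains\<close>

text \<open>From here on cochains are graded by the number \<open>m\<close> of vertices of a simplex, so that all
  degrees are natural numbers: degree \<open>m\<close> means dimension \<open>m - 1\<close>.\<close>
definition cochain_space :: "nat \<Rightarrow> ('a list \<Rightarrow> real) set" where
  "cochain_space m = cochains X (int m - 1)"

definition cob :: "nat \<Rightarrow> ('a list \<Rightarrow> real) \<Rightarrow> 'a list \<Rightarrow> real" where
  "cob m = coboundary X (int m - 1)"

lemma ordered_simplices_iff:
  "xs \<in> ordered_simplices X (int m - 1) \<longleftrightarrow> distinct xs \<and> set xs \<in> X \<and> length xs = m"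
  by (auto simp: ordered_simplices_def simplices_def simplex_dim_def distinct_card)

lemma cochain_space_iff:
  "\<phi> \<in> cochain_space m \<longleftrightarrow>
     alternating \<phi> \<and> (\<forall>xs. \<phi> xs \<noteq> 0 \<longrightarrow> distinct xs \<and> set xs \<in> X \<and> length xs = m)"
proof
  assume \<phi>: "\<phi> \<in> cochain_space m"
  have supp: "\<phi> xs = 0" if "\<not> (distinct xs \<and> set xs \<in> X \<and> length xs = m)" for xs
    using \<phi> that by (auto simp: cochain_space_def cochains_def ordered_simplices_iff)
  have perm: "\<phi> (permute_list p xs) = of_int (sign p) * \<phi> xs"
    if "distinct xs \<and> set xs \<in> X \<and> length xs = m" "p permutes {..<length xs}" for xs p
    using \<phi> that by (auto simp: cochain_space_def cochains_def ordered_simplices_iff)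
  have "\<phi> (as @ x # y # bs) = - \<phi> (as @ y # x # bs)" for as x y bs
  proof (cases "distinct (as @ y # x # bs) \<and> set (as @ y # x # bs) \<in> X
      \<and> length (as @ y # x # bs) = m")
    case True
    define p where "p = Transposition.transpose (length as) (Suc (length as))"
    have "permute_list p (as @ y # x # bs) = as @ x # y # bs"
      by (simp add: p_def permute_list_transpose list_update_append nth_append)
    moreover have "p permutes {..<length (as @ y # x # bs)}"
      unfolding p_def by (rule permutes_swap_id) auto
    ultimately have "\<phi> (as @ x # y # bs) = of_int (sign p) * \<phi> (as @ y # x # bs)"
      using perm[OF True] by metis
    then show ?thesis by (simp add: p_def sign_swap_id)
  next
    case False
    moreover have "set (as @ x # y # bs) = set (as @ y # x # bs)" by auto
    ultimately have "\<not> (distinct (as @ x # y # bs) \<and> set (as @ x # y # bs) \<in> X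
      \<and> length (as @ x # y # bs) = m)"
      by auto
    with False show ?thesis
      using supp[of "as @ x # y # bs"] supp[of "as @ y # x # bs"] by linarith
  qed
  with supp show "alternating \<phi> \<and> (\<forall>xs. \<phi> xs \<noteq> 0 \<longrightarrow> distinct xs \<and> set xs \<in> X \<and> length xs = m)"
    unfolding alternating_def by blast
next
  assume "alternating \<phi> \<and> (\<forall>xs. \<phi> xs \<noteq> 0 \<longrightarrow> distinct xs \<and> set xs \<in> X \<and> length xs = m)"
  then show "\<phi> \<in> cochain_space m"
    using alternating_permute_list[of \<phi>]
    by (auto simp: cochain_space_def cochains_def ordered_simplices_iff)
qed

lemma cochain_space_alternating: "\<phi> \<in> cochain_space m \<Longrightarrow> alternating \<phi>"
  by (simp add: cochain_space_iff)

lemma cochain_space_eq_0: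
  "\<phi> \<in> cochain_space m \<Longrightarrow> \<not> (distinct xs \<and> set xs \<in> X \<and> length xs = m) \<Longrightarrow> \<phi> xs = 0"
  unfolding cochain_space_iff by blast

lemma cochain_space_eq_0_tuples: "\<phi> \<in> cochain_space m \<Longrightarrow> xs \<notin> tuples m \<Longrightarrow> \<phi> xs = 0"
  using cochain_space_eq_0 simplex_subset by (fastforce simp: tuples_def)

lemma cochain_space_dot_eq_0: "\<phi> \<in> cochain_space m \<Longrightarrow> dot m \<phi> \<phi> = 0 \<Longrightarrow> \<phi> = (\<lambda>_. 0)"
  using cochain_space_eq_0_tuples dot_eq_0_iff by blast

lemma cochain_space_zero: "(\<lambda>_. 0) \<in> cochain_space m"
  by (simp add: cochain_space_iff alternating_def)

lemma cochain_space_linear: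
  assumes "f \<in> cochain_space m" "g \<in> cochain_space m"
  shows "(\<lambda>xs. f xs + t * g xs) \<in> cochain_space m"
proof -
  have "alternating (\<lambda>xs. f xs + t * g xs)"
    unfolding alternating_def
  proof (intro allI)
    fix as bs :: "'a list" and x y :: 'a
    show "f (as @ x # y # bs) + t * g (as @ x # y # bs)
        = - (f (as @ y # x # bs) + t * g (as @ y # x # bs))"
      using alternatingD[OF cochain_space_alternating[OF assms(1)], of as x y bs]
        alternatingD[OF cochain_space_alternating[OF assms(2)], of as x y bs] by simp
  qed
  then show ?thesis
    using cochain_space_eq_0[OF assms(1)] cochain_space_eq_0[OF assms(2)] unfolding cochain_space_iff by force
qed

lemma cochain_space_Cons:
  assumes "\<phi> \<in> cochain_space (Suc m)"
  shows "(\<lambda>zs. \<phi> (u # zs)) \<in> cochain_space m"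
proof -
  have "distinct zs \<and> set zs \<in> X \<and> length zs = m" if "\<phi> (u # zs) \<noteq> 0" for zs
  proof -
    have "distinct (u # zs) \<and> set (u # zs) \<in> X \<and> length (u # zs) = Suc m"
      using that assms by (meson cochain_space_eq_0)
    then show ?thesis using face_closed[of "set (u # zs)" "set zs"] by auto
  qed
  then show ?thesis
    using alternating_Cons[OF cochain_space_alternating[OF assms]] by (auto simp: cochain_space_iff)
qed

lemma codiff_in_cochain_space:
  assumes "\<psi> \<in> cochain_space (Suc m)"
  shows "codiff \<psi> \<in> cochain_space m"
proof -
  have "alternating (codiff \<psi>)"
    unfolding alternating_def
  proof (intro allI)
    fix as bs :: "'a list" and x y :: 'a
    have "\<psi> (u # as @ x # y # bs) = - \<psi> (u # as @ y # x # bs)" for u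
      using alternatingD[OF cochain_space_alternating[OF assms], of "u # as" x y bs] by simp
    then show "codiff \<psi> (as @ x # y # bs) = - codiff \<psi> (as @ y # x # bs)"
      by (simp add: codiff_def sum_negf)
  qed
  moreover have "codiff \<psi> xs = 0" if "\<not> (distinct xs \<and> set xs \<in> X \<and> length xs = m)" for xs
    using cochain_space_eq_0[OF cochain_space_Cons[OF assms] that] by (simp add: codiff_def)
  ultimately show ?thesis unfolding cochain_space_iff by blast
qed

lemma cob_eq:
  "cob m \<phi> xs = (if distinct xs \<and> set xs \<in> X \<and> length xs = Suc m then face_sum \<phi> xs else 0)"
  using ordered_simplices_iff[of xs "Suc m"] by (simp add: cob_def coboundary_def face_sum_eq_sum)

lemma cob_in_cochain_space:
  assumes "\<phi> \<in> cochain_space m"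
  shows "cob m \<phi> \<in> cochain_space (Suc m)"
proof -
  have "alternating (cob m \<phi>)"
    unfolding alternating_def
  proof (intro allI)
    fix as bs :: "'a list" and x y :: 'a
    have "set (as @ x # y # bs) = set (as @ y # x # bs)"
      "distinct (as @ x # y # bs) = distinct (as @ y # x # bs)"
      "length (as @ x # y # bs) = length (as @ y # x # bs)" by auto
    then show "cob m \<phi> (as @ x # y # bs) = - cob m \<phi> (as @ y # x # bs)"
      using alternatingD[OF alternating_face_sum[OF cochain_space_alternating[OF assms]], of as x y bs]
      unfolding cob_eq by (simp only: if_distrib[of uminus] minus_zero)
  qed
  then show ?thesis by (simp add: cochain_space_iff cob_eq)
qed

lemma cob_linear: "cob m (\<lambda>xs. f xs + t * g xs) xs = cob m f xs + t * cob m g xs"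
  by (simp add: cob_eq face_sum_linear)

lemma codiff_linear: "codiff (\<lambda>xs. f xs + t * g xs) xs = codiff f xs + t * codiff g xs"
  by (simp add: codiff_def sum.distrib sum_distrib_left)

text \<open>All facets of a simplex are simplices, so on a simplex of \<open>X\<close> the coboundary of \<open>X\<close>, applied
  twice, agrees with that of the full simplex.\<close>
lemma cob_cob: "cob (Suc m) (cob m \<phi>) = (\<lambda>_. 0)"
proof
  fix xs
  show "cob (Suc m) (cob m \<phi>) xs = 0"
  proof (cases "distinct xs \<and> set xs \<in> X \<and> length xs = Suc (Suc m)")
    case True
    have sub: "cob m \<phi> (take i xs @ drop (Suc i) xs) = face_sum \<phi> (take i xs @ drop (Suc i) xs)"
      if "i < length xs" for i
    proof -
      have "distinct (take i xs @ ([xs ! i] @ drop (Suc i) xs))"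
        using True that by (simp flip: id_take_nth_drop)
      then have "distinct (take i xs @ drop (Suc i) xs)" by auto
      moreover have "set (take i xs @ drop (Suc i) xs) \<subseteq> set xs"
        by (auto dest: in_set_takeD in_set_dropD)
      ultimately show ?thesis using True that face_closed by (auto simp: cob_eq)
    qed
    have "face_sum (cob m \<phi>) xs = face_sum (face_sum \<phi>) xs"
      by (simp add: face_sum_eq_sum[of "cob m \<phi>"] face_sum_eq_sum[of "face_sum \<phi>"] sub)
    then show ?thesis by (simp add: cob_eq[of "Suc m"] face_sum_face_sum)
  qed (auto simp: cob_eq)
qed

lemma dot_cob:
  assumes "\<psi> \<in> cochain_space (Suc m)"
  shows "dot (Suc m) (cob m \<chi>) \<psi> = real (Suc m) * dot m \<chi> (codiff \<psi>)"
proof -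
  have "dot (Suc m) (cob m \<chi>) \<psi> = dot (Suc m) (face_sum \<chi>) \<psi>"
    unfolding dot_def
    by (intro sum.cong refl) (use cochain_space_eq_0[OF assms] in \<open>auto simp: cob_eq\<close>)
  then show ?thesis by (simp add: dot_face_sum[OF cochain_space_alternating[OF assms]])
qed

text \<open>The signs of two cochains cancel in their product, so all orderings of a simplex contribute
  the same to \<open>dot\<close>.\<close>
lemma dot_eq_cochain_inner:
  assumes "f \<in> cochain_space m" "g \<in> cochain_space m"
  shows "dot m f g = fact m * cochain_inner X (int m - 1) f g"
proof -
  define S where "S = simplices X (int m - 1)"
  define T where "T = ordered_simplices X (int m - 1)"
  have "T \<subseteq> tuples m"
    using simplex_subset by (force simp: T_def ordered_simplices_iff tuples_def)
  have finT: "finite T" using \<open>T \<subseteq> tuples m\<close> finite_tuples by (rule finite_subset)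
  have finS: "finite S" using finite_X by (simp add: S_def simplices_def)
  have "dot m f g = (\<Sum>xs\<in>T. f xs * g xs)"
    unfolding dot_def
    by (rule sum.mono_neutral_right[OF finite_tuples \<open>T \<subseteq> tuples m\<close>])
       (use cochain_space_eq_0[OF assms(1)] in \<open>auto simp: T_def ordered_simplices_iff\<close>)
  also have "\<dots> = (\<Sum>\<sigma>\<in>S. \<Sum>xs\<in>{xs \<in> T. set xs = \<sigma>}. f xs * g xs)"
    by (rule sum.group[symmetric, OF finT finS]) (auto simp: T_def S_def ordered_simplices_def)
  also have "\<dots> = (\<Sum>\<sigma>\<in>S. fact m * (f (chosen_ordering \<sigma>) * g (chosen_ordering \<sigma>)))"
  proof (rule sum.cong[OF refl])
    fix \<sigma> assume "\<sigma> \<in> S"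
    then have \<sigma>: "\<sigma> \<in> X" "card \<sigma> = m" "finite \<sigma>"
      using simplex_subset finite_V
      by (auto simp: S_def simplices_def simplex_dim_def intro: finite_subset)
    define c where "c = chosen_ordering \<sigma>"
    have c: "distinct c" "set c = \<sigma>"
      using someI_ex[of "\<lambda>xs. distinct xs \<and> set xs = \<sigma>"] finite_distinct_list[OF \<sigma>(3)]
      unfolding c_def chosen_ordering_def by blast+
    have "{xs \<in> T. set xs = \<sigma>} = permutations_of_set \<sigma>"
      using \<sigma> by (auto simp: T_def ordered_simplices_iff permutations_of_set_def distinct_card)
    moreover have "f xs * g xs = f c * g c" if "xs \<in> permutations_of_set \<sigma>" for xs
    proof -
      have "mset xs = mset c"
        using that c by (metis permutations_of_setD set_eq_iff_mset_eq_distinct)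
      then obtain p where p: "p permutes {..<length c}" "permute_list p c = xs"
        by (rule mset_eq_permutation)
      have "(of_int (sign p) * of_int (sign p) :: real) = 1"
        by (simp flip: of_int_mult)
      then show ?thesis
        using alternating_permute_list[OF cochain_space_alternating[OF assms(1)] p(1)]
          alternating_permute_list[OF cochain_space_alternating[OF assms(2)] p(1)] p(2)
        by (simp add: algebra_simps)
    qed
    ultimately show "(\<Sum>xs\<in>{xs \<in> T. set xs = \<sigma>}. f xs * g xs) = fact m * (f c * g c)"
      using \<sigma> by simp
  qed
  finally show ?thesis
    by (simp add: cochain_inner_def S_def sum_distrib_left)
qed

text \<open>\<open>codiff\<close> has the adjointness property, and the property determines a cochain because the
  inner product is definite on cochains.\<close>
lemma coboundary_adj_eq_codiff:
  assumes "\<psi> \<in> cochain_space (Suc m)"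
  shows "coboundary_adj X (int m - 1) \<psi> = codiff \<psi>"
proof -
  have adj: "cochain_inner X (int m) (cob m \<chi>) \<psi> = cochain_inner X (int m - 1) \<chi> (codiff \<psi>)"
    if "\<chi> \<in> cochain_space m" for \<chi>
  proof -
    have "fact (Suc m) * cochain_inner X (int m) (cob m \<chi>) \<psi>
        = real (Suc m) * (fact m * cochain_inner X (int m - 1) \<chi> (codiff \<psi>))"
      using dot_cob[OF assms, of \<chi>] dot_eq_cochain_inner[OF cob_in_cochain_space[OF that] assms]
        dot_eq_cochain_inner[OF that codiff_in_cochain_space[OF assms]] by simp
    then show ?thesis by (simp add: field_simps del: of_nat_Suc)
  qed
  show ?thesis
    unfolding coboundary_adj_def
  proof (rule the_equality)
    show "codiff \<psi> \<in> cochains X (int m - 1) \<and>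
      (\<forall>\<chi>\<in>cochains X (int m - 1). cochain_inner X (int m - 1 + 1) (coboundary X (int m - 1) \<chi>) \<psi>
        = cochain_inner X (int m - 1) \<chi> (codiff \<psi>))"
      using adj codiff_in_cochain_space[OF assms] by (simp add: cochain_space_def cob_def)
  next
    fix \<phi>
    assume "\<phi> \<in> cochains X (int m - 1) \<and>
      (\<forall>\<chi>\<in>cochains X (int m - 1). cochain_inner X (int m - 1 + 1) (coboundary X (int m - 1) \<chi>) \<psi>
        = cochain_inner X (int m - 1) \<chi> \<phi>)"
    then have \<phi>: "\<phi> \<in> cochain_space m" and *:
      "\<forall>\<chi> \<in> cochain_space m. cochain_inner X (int m - 1) \<chi> \<phi> = cochain_inner X (int m - 1) \<chi> (codiff \<psi>)"
      using adj by (auto simp: cochain_space_def cob_def)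
    then have eq: "dot m \<chi> \<phi> = dot m \<chi> (codiff \<psi>)" if "\<chi> \<in> cochain_space m" for \<chi>
      using that * \<phi> by (simp add: dot_eq_cochain_inner codiff_in_cochain_space[OF assms])
    define \<chi> where "\<chi> = (\<lambda>xs. \<phi> xs + (-1) * codiff \<psi> xs)"
    have \<chi>: "\<chi> \<in> cochain_space m"
      unfolding \<chi>_def by (rule cochain_space_linear[OF \<phi> codiff_in_cochain_space[OF assms]])
    have "dot m \<chi> \<chi> = dot m \<chi> \<phi> - dot m \<chi> (codiff \<psi>)"
      unfolding dot_def sum_subtractf[symmetric]
      by (intro sum.cong refl) (simp add: \<chi>_def algebra_simps)
    then have "\<chi> = (\<lambda>_. 0)"
      using eq[OF \<chi>] cochain_space_dot_eq_0[OF \<chi>] by simp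
    then show "\<phi> = codiff \<psi>"
      by (auto simp: \<chi>_def fun_eq_iff)
  qed
qed

lemma laplacian_eq:
  assumes "\<phi> \<in> cochain_space (Suc m)"
  shows "laplacian X (int m) \<phi>
       = (\<lambda>xs. cob m (codiff \<phi>) xs + codiff (cob (Suc m) \<phi>) xs)"
  using coboundary_adj_eq_codiff[OF assms]
    coboundary_adj_eq_codiff[OF cob_in_cochain_space[OF assms]]
  by (simp add: laplacian_def cob_def)

section \<open>The defect\<close>

text \<open>What the coboundary of the full simplex sees outside \<open>X\<close>. Tuples with repeated entries do
  no harm, as \<open>face_sum\<close> of an alternating function vanishes there.\<close>
definition defect :: "nat \<Rightarrow> ('a list \<Rightarrow> real) \<Rightarrow> real" where
  "defect m \<phi> = (\<Sum>ys\<in>tuples (Suc m). if set ys \<in> X then 0 else (face_sum \<phi> ys)\<^sup>2)"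

abbreviation lap :: "nat \<Rightarrow> ('a list \<Rightarrow> real) \<Rightarrow> 'a list \<Rightarrow> real" where
  "lap m \<equiv> laplacian X (int m)"

lemma lap_in_cochain_space:
  assumes "\<phi> \<in> cochain_space (Suc m)"
  shows "lap m \<phi> \<in> cochain_space (Suc m)"
proof -
  have "(\<lambda>xs. cob m (codiff \<phi>) xs + 1 * codiff (cob (Suc m) \<phi>) xs) \<in> cochain_space (Suc m)"
    using assms by (intro cochain_space_linear cob_in_cochain_space codiff_in_cochain_space)
  then show ?thesis by (simp add: laplacian_eq[OF assms])
qed

lemma dot_lap:
  assumes "\<phi> \<in> cochain_space (Suc m)" "\<psi> \<in> cochain_space (Suc m)"
  shows "dot (Suc m) (lap m \<phi>) \<psi> = real (Suc m) * dot m (codiff \<phi>) (codiff \<psi>)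
    + dot (m + 2) (cob (Suc m) \<phi>) (cob (Suc m) \<psi>) / real (m + 2)"
proof -
  have "dot (Suc m) (lap m \<phi>) \<psi>
      = dot (Suc m) (cob m (codiff \<phi>)) \<psi> + dot (Suc m) \<psi> (codiff (cob (Suc m) \<phi>))"
    by (simp add: laplacian_eq[OF assms(1)] dot_def algebra_simps sum.distrib)
  also have "dot (Suc m) \<psi> (codiff (cob (Suc m) \<phi>))
      = dot (m + 2) (cob (Suc m) \<phi>) (cob (Suc m) \<psi>) / real (m + 2)"
    using dot_cob[OF cob_in_cochain_space[OF assms(1)], of \<psi>]
      dot_commute[of "m + 2" "cob (Suc m) \<phi>"] by simp
  finally show ?thesis by (simp add: dot_cob[OF assms(2)])
qed

text \<open>The key identity. Of the coboundary of the full simplex, the part on \<open>X\<close> is the coboundary of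
  \<open>X\<close>, and the squared norm of the part off \<open>X\<close> is the defect.\<close>
lemma dot_lap_self:
  assumes "\<phi> \<in> cochain_space (Suc m)"
  shows "dot (Suc m) (lap m \<phi>) \<phi>
       = real (card V) * dot (Suc m) \<phi> \<phi> - defect (Suc m) \<phi> / real (m + 2)"
proof -
  have alt: "alternating (face_sum \<phi>)"
    by (rule alternating_face_sum[OF cochain_space_alternating[OF assms]])
  have "face_sum \<phi> ys * face_sum \<phi> ys
      = cob (Suc m) \<phi> ys * cob (Suc m) \<phi> ys + (if set ys \<in> X then 0 else (face_sum \<phi> ys)\<^sup>2)"
    if "ys \<in> tuples (m + 2)" for ys
    using that alternating_not_distinct[OF alt, of ys]
    by (auto simp: cob_eq tuples_def power2_eq_square)
  then have "dot (m + 2) (face_sum \<phi>) (face_sum \<phi>)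
      = dot (m + 2) (cob (Suc m) \<phi>) (cob (Suc m) \<phi>) + defect (Suc m) \<phi>"
    by (simp add: dot_def defect_def flip: sum.distrib)
  then show ?thesis
    using dot_face_sum_self[OF cochain_space_alternating[OF assms], of m]
    by (simp add: dot_lap[OF assms assms] field_simps)
qed

text \<open>A non-face contains a missing face, and deleting any vertex outside that one leaves a
  non-face.\<close>
lemma card_nonface_facets:
  assumes "set ys \<subseteq> V" "set ys \<notin> X" "distinct ys"
    and "\<And>\<sigma>. \<sigma> \<in> missing_faces V X \<Longrightarrow> card \<sigma> \<le> Suc d"
  shows "length ys - Suc d \<le> card {i. i < length ys \<and> set (take i ys @ drop (Suc i) ys) \<notin> X}"
proof -
  define P where "P = {\<sigma>. \<sigma> \<subseteq> set ys \<and> \<sigma> \<notin> X}"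
  have "finite P" "P \<noteq> {}" using assms(2) by (auto simp: P_def)
  then obtain F where F: "F \<in> P" and min: "\<And>\<tau>. \<tau> \<in> P \<Longrightarrow> \<tau> \<subseteq> F \<Longrightarrow> F = \<tau>"
    using finite_has_minimal[of P] by blast
  have FV: "F \<subseteq> set ys" "F \<notin> X" using F by (auto simp: P_def)
  have "\<tau> \<in> X" if "\<tau> \<subset> F" for \<tau>
    using min[of \<tau>] that FV by (auto simp: P_def)
  then have "F \<in> missing_faces V X"
    using FV assms(1) by (auto simp: missing_faces_def)
  then have "card F \<le> Suc d" by (rule assms(4))
  define I where "I = {i. i < length ys \<and> ys ! i \<notin> F}"
  have "(!) ys ` I = set ys - F"
    by (auto simp: I_def in_set_conv_nth image_iff)
  moreover have "inj_on ((!) ys) I"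
    using assms(3) by (auto simp: I_def inj_on_def nth_eq_iff_index_eq)
  ultimately have "card I = card (set ys - F)"
    by (metis card_image)
  also have "\<dots> = length ys - card F"
    using FV by (simp add: card_Diff_subset finite_subset distinct_card[OF assms(3)])
  finally have "length ys - Suc d \<le> card I"
    using \<open>card F \<le> Suc d\<close> by simp
  also have "card I \<le> card {i. i < length ys \<and> set (take i ys @ drop (Suc i) ys) \<notin> X}"
  proof (rule card_mono)
    show "I \<subseteq> {i. i < length ys \<and> set (take i ys @ drop (Suc i) ys) \<notin> X}"
    proof
      fix i assume i: "i \<in> I"
      then have "set ys = insert (ys ! i) (set (take i ys @ drop (Suc i) ys))"
        using id_take_nth_drop[of i ys]
        by (metis (mono_tags, lifting) I_def mem_Collect_eq list.simps(15) set_append Un_insert_right)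
      then have "F \<subseteq> set (take i ys @ drop (Suc i) ys)"
        using FV(1) i by (auto simp: I_def)
      then show "i \<in> {i. i < length ys \<and> set (take i ys @ drop (Suc i) ys) \<notin> X}"
        using face_closed FV(2) i unfolding I_def by blast
    qed
  qed simp
  finally show ?thesis .
qed

text \<open>
  On the right, the value of the full coboundary of \<open>\<phi>\<close> at a tuple is counted exactly if dropping
  the first entry leaves a non-face. Since its square does not depend on the order of the
  entries, the first position may be replaced by any of the \<open>m + 2\<close> positions. Summing over
  all of them counts each non-face as often as it has facets that are non-faces.
\<close>
lemma defect_link_bound:
  assumes \<phi>: "\<phi> \<in> cochain_space (Suc m)"
    and missing: "\<And>\<sigma>. \<sigma> \<in> missing_faces V X \<Longrightarrow> card \<sigma> \<le> Suc d"
    and "d \<le> m"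
  shows "real (Suc m - d) * defect (Suc m) \<phi> \<le> real (m + 2) * (\<Sum>u\<in>V. defect m (\<lambda>zs. \<phi> (u # zs)))"
proof -
  define A where "A = (\<lambda>ys. (face_sum \<phi> ys)\<^sup>2)"
  define N where "N = (\<lambda>ys. {i. i < length ys \<and> set (take i ys @ drop (Suc i) ys) \<notin> X})"
  define D where "D = (\<Sum>u\<in>V. defect m (\<lambda>zs. \<phi> (u # zs)))"
  have alt: "alternating (face_sum \<phi>)"
    by (rule alternating_face_sum[OF cochain_space_alternating[OF \<phi>]])
  \<comment> \<open>At a non-face \<open>xs\<close> the function \<open>\<phi>\<close> vanishes, so \<open>face_sum \<phi> (u # xs)\<close> is the negative of
    the coboundary of the contraction.\<close>
  have D: "D = (\<Sum>u\<in>V. \<Sum>xs\<in>tuples (Suc m). if set xs \<in> X then 0 else A (u # xs))"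
    using cochain_space_eq_0[OF \<phi>] by (auto simp: D_def defect_def A_def intro!: sum.cong)
  \<comment> \<open>The sum defining \<open>D\<close> can be read off at any position \<open>i\<close> in place of the first.\<close>
  have "(\<Sum>ys\<in>tuples (m + 2). if i \<in> N ys then A ys else 0) = D" if "i < m + 2" for i
  proof -
    have "(\<Sum>ys\<in>tuples (m + 2). if i \<in> N ys then A ys else 0) = (\<Sum>u\<in>V. \<Sum>xs\<in>tuples (Suc m).
        if i \<in> N (take i xs @ u # drop i xs) then A (take i xs @ u # drop i xs) else 0)"
      using that sum_tuples_insert[of i "Suc m"] by simp
    also have "\<dots> = D"
      unfolding D
    proof (intro sum.cong refl)
      fix u xs assume "xs \<in> tuples (Suc m)"
      then have i: "i \<le> length xs" using that by (simp add: tuples_def)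
      have "A (take i xs @ u # drop i xs) = A (u # xs)"
        using alternating_insert[OF alt, of "[]" "take i xs" u "drop i xs"]
        by (simp add: A_def power_mult_distrib flip: power_mult)
      moreover have "i \<in> N (take i xs @ u # drop i xs) \<longleftrightarrow> set xs \<notin> X"
      proof -
        have "take i (take i xs @ u # drop i xs) @ drop (Suc i) (take i xs @ u # drop i xs) = xs"
          using i by simp
        moreover have "i < length (take i xs @ u # drop i xs)" using i by simp
        ultimately show ?thesis unfolding N_def by (metis (no_types, lifting) mem_Collect_eq)
      qed
      ultimately show "(if i \<in> N (take i xs @ u # drop i xs)
          then A (take i xs @ u # drop i xs) else 0) = (if set xs \<in> X then 0 else A (u # xs))"
        by simp
    qed
    finally show ?thesis .
  qed
  then have "real (m + 2) * D
      = (\<Sum>i<m + 2. \<Sum>ys\<in>tuples (m + 2). if i \<in> N ys then A ys else 0)"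
    by (simp del: sum.lessThan_Suc add_2_eq_Suc')
  also have "\<dots> = (\<Sum>ys\<in>tuples (m + 2). \<Sum>i<m + 2. if i \<in> N ys then A ys else 0)"
    by (rule sum.swap)
  also have "\<dots> = (\<Sum>ys\<in>tuples (m + 2). real (card (N ys)) * A ys)"
  proof (rule sum.cong[OF refl])
    fix ys assume "ys \<in> tuples (m + 2)"
    then have "{..<m + 2} \<inter> N ys = N ys"
      by (auto simp: N_def tuples_def)
    then show "(\<Sum>i<m + 2. if i \<in> N ys then A ys else 0) = real (card (N ys)) * A ys"
      by (simp add: sum.If_cases del: sum.lessThan_Suc add_2_eq_Suc')
  qed
  also have "\<dots> \<ge> (\<Sum>ys\<in>tuples (m + 2). real (Suc m - d) * (if set ys \<in> X then 0 else A ys))"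
  proof (rule sum_mono)
    fix ys assume ys: "ys \<in> tuples (m + 2)"
    show "real (Suc m - d) * (if set ys \<in> X then 0 else A ys) \<le> real (card (N ys)) * A ys"
    proof (cases "set ys \<in> X \<or> \<not> distinct ys")
      case True
      then show ?thesis using alternating_not_distinct[OF alt, of ys] by (auto simp: A_def)
    next
      case False
      then have "length ys - Suc d \<le> card (N ys)"
        unfolding N_def using ys by (intro card_nonface_facets missing) (auto simp: tuples_def)
      then have "Suc m - d \<le> card (N ys)" using ys by (simp add: tuples_def)
      then show ?thesis using False by (simp add: A_def mult_right_mono)
    qed
  qed
  also have "(\<Sum>ys\<in>tuples (m + 2). real (Suc m - d) * (if set ys \<in> X then 0 else A ys))
      = real (Suc m - d) * defect (Suc m) \<phi>"
    by (simp only: defect_def A_def sum_distrib_left add_2_eq_Suc')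
  finally show ?thesis
    by (simp only: D_def)
qed

text \<open>The step from \<open>m\<close> to \<open>m + 1\<close> multiplies the constant by \<open>(m + 1) / (m + 1 - d)\<close>, which
  is also the quotient of the binomial coefficients.\<close>
lemma defect_bound_all_degrees:
  assumes missing: "\<And>\<sigma>. \<sigma> \<in> missing_faces V X \<Longrightarrow> card \<sigma> \<le> Suc d"
    and base: "\<And>\<phi>. \<phi> \<in> cochain_space d \<Longrightarrow> defect d \<phi> \<le> c * real (Suc d) * dot d \<phi> \<phi>"
    and "d \<le> m" and "\<phi> \<in> cochain_space m"
  shows "defect m \<phi> \<le> c * real (m choose d) * real (Suc m) * dot m \<phi> \<phi>"
  using assms(3,4)
proof (induction m arbitrary: \<phi> rule: dec_induct)
  case base
  then show ?case using assms(2) by simp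
next
  case (step m)
  let ?r = "real (Suc m - d)"
  have "?r * defect (Suc m) \<phi> \<le> real (m + 2) * (\<Sum>u\<in>V. defect m (\<lambda>zs. \<phi> (u # zs)))"
    using step by (intro defect_link_bound missing) auto
  also have "\<dots> \<le> real (m + 2) *
      (\<Sum>u\<in>V. c * real (m choose d) * real (Suc m) * dot m (\<lambda>zs. \<phi> (u # zs)) (\<lambda>zs. \<phi> (u # zs)))"
    using step by (intro mult_left_mono sum_mono step.IH cochain_space_Cons) auto
  also have "\<dots> = real (m + 2) * (c * (real (Suc m) * real (m choose d)) * dot (Suc m) \<phi> \<phi>)"
    by (simp add: dot_def sum_tuples_Suc sum_distrib_left algebra_simps)
  also have "real (Suc m) * real (m choose d) = ?r * real (Suc m choose d)"
  proof -
    have "(Suc m - d) * (Suc m choose d) = Suc m * (m choose d)"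
      using binomial_absorb_comp[of "Suc m" d] by simp
    then show ?thesis by (metis of_nat_mult)
  qed
  finally have "?r * defect (Suc m) \<phi>
      \<le> ?r * (c * real (Suc m choose d) * real (Suc (Suc m)) * dot (Suc m) \<phi> \<phi>)"
    by (simp add: algebra_simps)
  moreover have "?r > 0" using step by simp
  ultimately show ?case by (simp only: mult_le_cancel_left_pos)
qed

end


section \<open>Symmetric operators on finite-dimensional function spaces\<close>

text \<open>The first variation: a quadratic function of \<open>t\<close> that vanishes at its minimum \<open>t = 0\<close> has no
  linear term.\<close>
lemma linear_coefficient_eq_0:
  fixes a b :: real
  assumes "\<And>t. 0 \<le> 2 * t * a + t\<^sup>2 * b"
  shows "a = 0"
proof (rule ccontr)
  assume "a \<noteq> 0"
  \<comment> \<open>At \<open>t = - a / c\<close> with \<open>c > b\<close> the linear term outweighs the quadratic one.\<close>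
  define c where "c = \<bar>b\<bar> + 1"
  have c: "c > 0" "b < c" by (auto simp: c_def)
  have "2 * (- a / c) * a + (- a / c)\<^sup>2 * b = a\<^sup>2 / c * (b / c - 2)"
    using c by (simp add: field_simps power2_eq_square)
  moreover have "a\<^sup>2 / c * (b / c - 2) < 0"
  proof (rule mult_pos_neg)
    have "b / c < 1" using c by simp
    then show "b / c - 2 < 0" by simp
  qed (use c \<open>a \<noteq> 0\<close> in simp)
  ultimately have "2 * (- a / c) * a + (- a / c)\<^sup>2 * b < 0"
    by (simp only:)
  with assms[of "- a / c"] show False by simp
qed

text \<open>
  The functions in \<open>C\<close> are supported on the finite set \<open>S\<close>, so \<open>C\<close> is a Euclidean space in
  disguise. It carries the topology of pointwise convergence, in which its closed balls are compact
  by Tychonoff's theorem.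
\<close>
locale symmetric_operator =
  fixes S :: "'b set" and C :: "('b \<Rightarrow> real) set"
    and L :: "('b \<Rightarrow> real) \<Rightarrow> 'b \<Rightarrow> real"
    and inner :: "('b \<Rightarrow> real) \<Rightarrow> ('b \<Rightarrow> real) \<Rightarrow> real"
  assumes inner_def: "inner f g = (\<Sum>x\<in>S. f x * g x)"
    and finite_S: "finite S"
    and supported: "f \<in> C \<Longrightarrow> x \<notin> S \<Longrightarrow> f x = 0"
    and closed_C: "closed C"
    and zero_C: "(\<lambda>_. 0) \<in> C"
    and combination_C: "f \<in> C \<Longrightarrow> g \<in> C \<Longrightarrow> (\<lambda>x. f x + t * g x) \<in> C"
    and L_C: "f \<in> C \<Longrightarrow> L f \<in> C"
    and L_linear: "f \<in> C \<Longrightarrow> g \<in> C \<Longrightarrow> L (\<lambda>x. f x + t * g x) = (\<lambda>x. L f x + t * L g x)"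
    and L_symmetric: "f \<in> C \<Longrightarrow> g \<in> C \<Longrightarrow> inner (L f) g = inner f (L g)"
    and L_continuous: "continuous_on C (\<lambda>f. L f x)"
begin

lemma inner_commute: "inner f g = inner g f"
  by (simp add: inner_def mult.commute)

lemma inner_add_left: "inner (\<lambda>x. f x + t * g x) h = inner f h + t * inner g h"
  by (simp add: inner_def algebra_simps sum.distrib sum_distrib_left)

lemma inner_add_right: "inner h (\<lambda>x. f x + t * g x) = inner h f + t * inner h g"
  using inner_add_left[of f t g h] by (simp add: inner_commute)

lemma inner_nonneg: "0 \<le> inner f f"
  by (simp add: inner_def sum_nonneg)

lemma inner_eq_0: "f \<in> C \<Longrightarrow> inner f f = 0 \<Longrightarrow> f = (\<lambda>_. 0)"
  using supported by (auto simp: inner_def sum_nonneg_eq_0_iff finite_S)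

lemma scale_C: "f \<in> C \<Longrightarrow> (\<lambda>x. t * f x) \<in> C"
  using combination_C[OF zero_C, of f t] by simp

lemma L_scale: "f \<in> C \<Longrightarrow> L (\<lambda>x. t * f x) = (\<lambda>x. t * L f x)"
proof -
  assume f: "f \<in> C"
  have "L (\<lambda>x. f x + (t - 1) * f x) = (\<lambda>x. L f x + (t - 1) * L f x)"
    by (rule L_linear[OF f f])
  then show ?thesis by (simp add: algebra_simps)
qed

lemma eq_if_inner_eq:
  assumes "f \<in> C" "g \<in> C" and "\<And>h. h \<in> C \<Longrightarrow> inner f h = inner g h"
  shows "f = g"
proof -
  define e where "e = (\<lambda>x. f x + (- 1) * g x)"
  have e: "e \<in> C" unfolding e_def by (rule combination_C[OF assms(1,2)])
  have "inner e e = inner f e + (- 1) * inner g e"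
    unfolding e_def by (rule inner_add_left)
  then have "e = (\<lambda>_. 0)" using inner_eq_0[OF e] assms(3)[OF e] by simp
  then show ?thesis by (auto simp: e_def fun_eq_iff)
qed

lemma continuous_inner:
  assumes "\<And>x. continuous_on A (\<lambda>f. F f x)" "\<And>x. continuous_on A (\<lambda>f. G f x)"
  shows "continuous_on A (\<lambda>f. inner (F f) (G f))"
  unfolding inner_def by (intro continuous_intros assms)

lemma continuous_coordinate: "continuous_on A (\<lambda>f :: 'b \<Rightarrow> real. f x)"
  by (rule continuous_on_subset[OF continuous_on_product_coordinates]) simp

lemma compact_ball: "compact {f \<in> C. inner f f \<le> R}"
proof -
  define B where "B = (\<lambda>x. if x \<in> S then {- sqrt R..sqrt R} else {0 :: real})"
  have "compactin (product_topology (\<lambda>_. euclidean) UNIV) (PiE UNIV B)"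
    unfolding compactin_PiE by (auto simp: B_def)
  then have "compact (PiE UNIV B)"
    by (simp add: euclidean_product_topology)
  moreover have "closed {f \<in> C. inner f f \<le> R}"
  proof -
    have "closed {f. inner f f \<le> R}"
      by (intro closed_Collect_le continuous_inner continuous_coordinate continuous_intros)
    then have "closed (C \<inter> {f. inner f f \<le> R})" by (rule closed_Int[OF closed_C])
    also have "C \<inter> {f. inner f f \<le> R} = {f \<in> C. inner f f \<le> R}" by blast
    finally show ?thesis .
  qed
  moreover have "{f \<in> C. inner f f \<le> R} \<subseteq> PiE UNIV B"
  proof
    fix f assume f: "f \<in> {f \<in> C. inner f f \<le> R}"
    have "f x \<in> B x" for x
    proof (cases "x \<in> S")
      case True
      then have "f x * f x \<le> inner f f"
        unfolding inner_def by (intro member_le_sum[of x S "\<lambda>x. f x * f x"]) (auto simp: finite_S)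
      then have "(f x)\<^sup>2 \<le> R" using f by (simp add: power2_eq_square)
      then have "\<bar>f x\<bar> \<le> sqrt R" by (rule real_le_rsqrt[of "\<bar>f x\<bar>", simplified])
      then show ?thesis using True by (auto simp: B_def)
    next
      case False
      then show ?thesis using f supported by (simp add: B_def)
    qed
    then show "f \<in> PiE UNIV B" by (auto simp: PiE_iff)
  qed
  ultimately show ?thesis
    using compact_Int_closed[of "PiE UNIV B" "{f \<in> C. inner f f \<le> R}"] by (simp add: Int_absorb1)
qed

text \<open>A minimizer of the quadratic function \<open>\<langle>M f, f\<rangle> - 2 \<langle>b, f\<rangle>\<close> solves the linear equation
  \<open>M f = b\<close>. It is applied with \<open>M = L - l\<close>, \<open>b = 0\<close> for eigenvectors and with \<open>M = L\<close> for
  surjectivity.\<close>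
lemma minimizer_is_critical:
  assumes L': "\<And>f g t. f \<in> C \<Longrightarrow> g \<in> C \<Longrightarrow> M (\<lambda>x. f x + t * g x) = (\<lambda>x. M f x + t * M g x)"
    and sym: "\<And>f g. f \<in> C \<Longrightarrow> g \<in> C \<Longrightarrow> inner (M f) g = inner f (M g)"
    and v: "v \<in> C" and b: "b \<in> C" and Mv: "M v \<in> C"
    and min: "\<And>f. f \<in> C \<Longrightarrow> inner (M v) v - 2 * inner b v \<le> inner (M f) f - 2 * inner b f"
  shows "M v = b"
proof (rule eq_if_inner_eq[OF Mv b])
  fix h assume h: "h \<in> C"
  have "inner (M v) h - inner b h = 0"
  proof (rule linear_coefficient_eq_0)
    fix t
    have "inner (M (\<lambda>x. v x + t * h x)) (\<lambda>x. v x + t * h x)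
        = inner (M v) v + 2 * t * inner (M v) h + t\<^sup>2 * inner (M h) h"
      using sym[OF v h]
      by (simp add: L'[OF v h] inner_add_left inner_add_right inner_commute[of "M h" v]
          algebra_simps power2_eq_square)
    moreover have "inner b (\<lambda>x. v x + t * h x) = inner b v + t * inner b h"
      by (rule inner_add_right)
    ultimately show "0 \<le> 2 * t * (inner (M v) h - inner b h) + t\<^sup>2 * inner (M h) h"
      using min[OF combination_C[OF v h, of t]] by (simp add: algebra_simps)
  qed
  then show "inner (M v) h = inner b h" by simp
qed

text \<open>The minimum of the Rayleigh quotient is attained on the compact unit sphere.\<close>
theorem ex_least_eigenvalue:
  assumes "f0 \<in> C" "f0 \<noteq> (\<lambda>_. 0)"
  obtains l v where "v \<in> C" "v \<noteq> (\<lambda>_. 0)" "L v = (\<lambda>x. l * v x)"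
    and "\<And>f. f \<in> C \<Longrightarrow> l * inner f f \<le> inner (L f) f"
proof -
  define K where "K = {f \<in> C. inner f f = 1}"
  have normalize: "(\<lambda>x. 1 / sqrt (inner f f) * f x) \<in> K" if "f \<in> C" "f \<noteq> (\<lambda>_. 0)" for f
  proof -
    have "inner f f > 0" using inner_nonneg[of f] inner_eq_0[of f] that by fastforce
    moreover have "inner (\<lambda>x. t * f x) (\<lambda>x. t * f x) = t\<^sup>2 * inner f f" for t
      by (simp add: inner_def sum_distrib_left power2_eq_square algebra_simps)
    ultimately have "inner (\<lambda>x. 1 / sqrt (inner f f) * f x) (\<lambda>x. 1 / sqrt (inner f f) * f x) = 1"
      by (simp only:) (simp add: power_divide)
    then show ?thesis
      using scale_C[OF that(1)] unfolding K_def by blast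
  qed
  have "closed {f. inner f f = 1}"
    by (intro closed_Collect_eq continuous_inner continuous_coordinate continuous_intros)
  moreover have "K = {f \<in> C. inner f f \<le> 1} \<inter> {f. inner f f = 1}"
    by (auto simp: K_def)
  ultimately have "compact K"
    using compact_Int_closed[OF compact_ball] by simp
  moreover have "K \<noteq> {}" using normalize[OF assms] by blast
  moreover have "continuous_on K (\<lambda>f. inner (L f) f)"
    by (intro continuous_inner continuous_coordinate continuous_on_subset[OF L_continuous])
       (auto simp: K_def)
  ultimately obtain v where v: "v \<in> K"
    and min: "\<And>f. f \<in> K \<Longrightarrow> inner (L v) v \<le> inner (L f) f"
    using continuous_attains_inf[of K "\<lambda>f. inner (L f) f"] by blast
  define l where "l = inner (L v) v"
  have vC: "v \<in> C" and "inner v v = 1" using v by (auto simp: K_def)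
  have bound: "l * inner f f \<le> inner (L f) f" if f: "f \<in> C" for f
  proof (cases "f = (\<lambda>_. 0)")
    case False
    have pos: "inner f f > 0" using inner_nonneg[of f] inner_eq_0[OF f] False by fastforce
    define t where "t = 1 / sqrt (inner f f)"
    have "l \<le> inner (L (\<lambda>x. t * f x)) (\<lambda>x. t * f x)"
      using min[OF normalize[OF f False]] by (simp only: l_def t_def)
    also have "\<dots> = t\<^sup>2 * inner (L f) f"
      by (simp add: L_scale[OF f] inner_def sum_distrib_left power2_eq_square algebra_simps)
    also have "t\<^sup>2 = 1 / inner f f" using pos by (simp add: t_def power_divide)
    finally show ?thesis using pos by (simp add: field_simps)
  qed (simp add: inner_def)
  \<comment> \<open>\<open>v\<close> minimizes the quadratic form of \<open>L - l\<close>, so it lies in its kernel.\<close>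
  define M where "M = (\<lambda>f x. L f x + (- l) * f x)"
  have quad: "inner (M f) g = inner (L f) g - l * inner f g" for f g
    unfolding M_def inner_add_left by simp
  have "M v = (\<lambda>_. 0)"
  proof (rule minimizer_is_critical[where M = M])
    show "M (\<lambda>x. f x + t * g x) = (\<lambda>x. M f x + t * M g x)" if "f \<in> C" "g \<in> C" for f g t
      by (simp add: M_def L_linear[OF that] algebra_simps)
    show "inner (M f) g = inner f (M g)" if "f \<in> C" "g \<in> C" for f g
      using L_symmetric[OF that]
      by (simp add: quad inner_commute[of f "M g"] inner_commute[of f "L g"] inner_commute[of f g])
    show "M v \<in> C" unfolding M_def by (rule combination_C[OF L_C[OF vC] vC])
    show "inner (M v) v - 2 * inner (\<lambda>_. 0) v \<le> inner (M f) f - 2 * inner (\<lambda>_. 0) f"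
      if "f \<in> C" for f
    proof -
      have "inner (\<lambda>_. 0) g = 0" for g by (simp add: inner_def)
      moreover have "inner (M v) v = 0"
        using \<open>inner v v = 1\<close> by (simp add: quad l_def)
      ultimately show ?thesis using bound[OF that] by (simp add: quad)
    qed
  qed (use vC zero_C in auto)
  then have "L v = (\<lambda>x. l * v x)"
    by (auto simp: M_def fun_eq_iff)
  moreover have "v \<noteq> (\<lambda>_. 0)" using \<open>inner v v = 1\<close> by (auto simp: inner_def)
  ultimately show thesis using that[of v l] vC bound by blast
qed

text \<open>
  The function \<open>F f = \<langle>L f, f\<rangle> - 2 \<langle>b, f\<rangle>\<close> is positive outside a ball and vanishes at its
  centre, so its minimum over the ball is a global one. The radius comes from
  \<open>2 \<langle>b, f\<rangle> \<le> e/2 \<parallel>f\<parallel>\<^sup>2 + 2/e \<parallel>b\<parallel>\<^sup>2\<close>.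
\<close>
theorem coercive_imp_surjective:
  assumes e: "e > 0" and coercive: "\<And>f. f \<in> C \<Longrightarrow> e * inner f f \<le> inner (L f) f"
    and b: "b \<in> C"
  obtains v where "v \<in> C" "L v = b"
proof -
  define F where "F = (\<lambda>f. inner (L f) f - 2 * inner b f)"
  define R where "R = 4 * inner b b / e\<^sup>2"
  define K where "K = {f \<in> C. inner f f \<le> R}"
  have outside: "0 < F f" if "f \<in> C" "f \<notin> K" for f
  proof -
    have "2 * (b x * f x) \<le> e / 2 * (f x * f x) + 2 / e * (b x * b x)" for x
    proof -
      have "0 \<le> (e * f x - 2 * b x)\<^sup>2 / (2 * e)" using e by simp
      then show ?thesis using e by (simp add: field_simps power2_eq_square)
    qed
    then have "2 * inner b f \<le> e / 2 * inner f f + 2 / e * inner b b"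
      unfolding inner_def sum_distrib_left sum.distrib[symmetric] by (rule sum_mono)
    moreover have "2 / e * inner b b < e / 2 * inner f f"
    proof -
      have "R < inner f f" using that by (simp add: K_def)
      then have "e / 2 * R < e / 2 * inner f f" using e by simp
      then show ?thesis using e by (simp add: R_def power2_eq_square)
    qed
    ultimately show ?thesis using coercive[OF that(1)] by (simp add: F_def)
  qed
  have zero: "(\<lambda>_. 0) \<in> K" "F (\<lambda>_. 0) = 0"
    using zero_C inner_nonneg[of b] by (simp_all add: K_def F_def R_def inner_def)
  have "compact K" unfolding K_def by (rule compact_ball)
  moreover have "K \<noteq> {}" using zero by blast
  moreover have "continuous_on K F"
    unfolding F_def
    by (intro continuous_intros continuous_inner continuous_coordinate
        continuous_on_subset[OF L_continuous]) (auto simp: K_def)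
  ultimately obtain v where v: "v \<in> K" and min: "\<And>f. f \<in> K \<Longrightarrow> F v \<le> F f"
    using continuous_attains_inf[of K F] by blast
  have vC: "v \<in> C" using v by (simp add: K_def)
  have "L v = b"
  proof (rule minimizer_is_critical[where M = L])
    show "inner (L v) v - 2 * inner b v \<le> inner (L f) f - 2 * inner b f" if "f \<in> C" for f
    proof (cases "f \<in> K")
      case True
      then show ?thesis using min[of f] by (simp add: F_def)
    next
      case False
      then show ?thesis using outside[OF that False] min[OF zero(1)] zero(2) by (simp add: F_def)
    qed
  qed (use vC b L_C L_linear L_symmetric in auto)
  then show thesis using that vC by blast
qed

end


context finite_complex
begin

section \<open>The Laplacian and cohomology\<close>

lemma closed_cochain_space: "closed (cochain_space m)"
proof -
  have "cochain_space m =
      {\<phi>. \<forall>as x y bs. \<phi> (as @ x # y # bs) = - \<phi> (as @ y # x # bs)} \<inter>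
      {\<phi>. \<forall>xs. \<not> (distinct xs \<and> set xs \<in> X \<and> length xs = m) \<longrightarrow> \<phi> xs = 0}"
    unfolding cochain_space_iff alternating_def set_eq_iff by blast
  also have "closed \<dots>"
    by (intro closed_Int closed_Collect_all closed_Collect_imp closed_Collect_eq
        continuous_intros continuous_on_product_coordinates) simp
  finally show ?thesis .
qed

lemma symmetric_operator_lap:
  "symmetric_operator (tuples (Suc m)) (cochain_space (Suc m)) (lap m) (dot (Suc m))"
proof
  have coord: "continuous_on A (\<lambda>f :: 'a list \<Rightarrow> real. f x)" for A x
    by (rule continuous_on_subset[OF continuous_on_product_coordinates]) simp
  show "lap m (\<lambda>x. f x + t * g x) = (\<lambda>x. lap m f x + t * lap m g x)"
    if f: "f \<in> cochain_space (Suc m)" and g: "g \<in> cochain_space (Suc m)" for f g t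
  proof -
    have "codiff (\<lambda>x. f x + t * g x) = (\<lambda>xs. codiff f xs + t * codiff g xs)"
      "cob (Suc m) (\<lambda>x. f x + t * g x) = (\<lambda>xs. cob (Suc m) f xs + t * cob (Suc m) g xs)"
      by (simp_all add: fun_eq_iff codiff_linear cob_linear)
    then show ?thesis
      by (simp add: laplacian_eq cochain_space_linear f g codiff_linear cob_linear algebra_simps)
  qed
  show "dot (Suc m) (lap m f) g = dot (Suc m) f (lap m g)"
    if "f \<in> cochain_space (Suc m)" "g \<in> cochain_space (Suc m)" for f g
    using that dot_lap[of f m g] dot_lap[of g m f] dot_commute[of _ f] dot_commute
    by metis
  have cont: "continuous_on A (\<lambda>f. cob i (g f) xs)"
    if "\<And>zs. continuous_on A (\<lambda>f. g f zs)"
    for A :: "('a list \<Rightarrow> real) set" and g :: "('a list \<Rightarrow> real) \<Rightarrow> 'a list \<Rightarrow> real" and i xs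
    using continuous_on_face_sum[of A g xs, OF that]
    unfolding cob_eq
    by (cases "distinct xs \<and> set xs \<in> X \<and> length xs = Suc i")
       (simp_all only: simp_thms if_True if_False continuous_on_const)
  have "continuous_on (cochain_space (Suc m))
      (\<lambda>f. cob m (codiff f) x + codiff (cob (Suc m) f) x)" for x
  proof -
    have "continuous_on A (\<lambda>f. codiff f xs)" for A :: "('a list \<Rightarrow> real) set" and xs
      unfolding codiff_def by (intro continuous_intros coord)
    then have "continuous_on A (\<lambda>f. cob m (codiff f) xs)" for A :: "('a list \<Rightarrow> real) set" and xs
      by (rule cont)
    moreover have "continuous_on A (\<lambda>f. cob (Suc m) f xs)" for A :: "('a list \<Rightarrow> real) set" and xs
      by (intro cont coord)
    ultimately show ?thesis
      unfolding codiff_def[of "cob (Suc m) _"] by (intro continuous_intros)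
  qed
  then show "continuous_on (cochain_space (Suc m)) (\<lambda>f. lap m f x)" for x
    by (simp add: laplacian_eq cong: continuous_on_cong)
qed (auto simp: dot_def finite_tuples closed_cochain_space cochain_space_zero
    cochain_space_linear lap_in_cochain_space intro: cochain_space_eq_0_tuples)

text \<open>The least eigenvalue exists as soon as there is a nonzero cochain, and it is then the minimum
  of the Rayleigh quotient.\<close>
lemma min_eigenvalue_le_rayleigh:
  assumes "\<phi> \<in> cochain_space (Suc m)"
  shows "min_eigenvalue X (int m) * dot (Suc m) \<phi> \<phi> \<le> dot (Suc m) (lap m \<phi>) \<phi>"
proof (cases "\<phi> = (\<lambda>_. 0)")
  case True
  then show ?thesis by (simp add: dot_def)
next
  case False
  interpret symmetric_operator "tuples (Suc m)" "cochain_space (Suc m)" "lap m" "dot (Suc m)"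
    by (rule symmetric_operator_lap)
  obtain l v where v: "v \<in> cochain_space (Suc m)" "v \<noteq> (\<lambda>_. 0)" "lap m v = (\<lambda>x. l * v x)"
    and bound: "\<And>f. f \<in> cochain_space (Suc m) \<Longrightarrow> l * dot (Suc m) f f \<le> dot (Suc m) (lap m f) f"
    using ex_least_eigenvalue[OF assms False] by metis
  have C: "cochains X (int m) = cochain_space (Suc m)"
    by (simp add: cochain_space_def)
  have "min_eigenvalue X (int m) = l"
    unfolding min_eigenvalue_def
  proof (rule Least_equality)
    show "laplacian_eigenvalue X (int m) l"
      using v by (auto simp: laplacian_eigenvalue_def C)
  next
    fix l' assume "laplacian_eigenvalue X (int m) l'"
    then obtain w where w: "w \<in> cochain_space (Suc m)" "w \<noteq> (\<lambda>_. 0)" "lap m w = (\<lambda>x. l' * w x)"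
      by (auto simp: laplacian_eigenvalue_def C)
    have "dot (Suc m) (lap m w) w = l' * dot (Suc m) w w"
      by (simp add: w(3) dot_def sum_distrib_left mult.assoc)
    moreover have "dot (Suc m) w w > 0"
      using dot_nonneg[of "Suc m" w] cochain_space_dot_eq_0[OF w(1)] w(2) by fastforce
    ultimately show "l \<le> l'" using bound[OF w(1)] by simp
  qed
  then show ?thesis using bound[OF assms] by simp
qed

text \<open>
  Hodge theory without harmonic cochains. By surjectivity \<open>\<phi> = L \<chi>\<close>, a coboundary plus a
  cochain \<open>\<alpha>\<close> in the image of the adjoint. As \<open>\<phi>\<close> is a cocycle, so is \<open>\<alpha>\<close>; but the image of
  the adjoint is orthogonal to the cocycles, so \<open>\<alpha> = 0\<close>.
\<close>
lemma cocycle_is_coboundary: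
  assumes "e > 0"
    and "\<And>\<phi>. \<phi> \<in> cochain_space (Suc m) \<Longrightarrow> e * dot (Suc m) \<phi> \<phi> \<le> dot (Suc m) (lap m \<phi>) \<phi>"
    and \<phi>: "\<phi> \<in> cochain_space (Suc m)" "cob (Suc m) \<phi> = (\<lambda>_. 0)"
  shows "\<phi> \<in> cob m ` cochain_space m"
proof -
  interpret symmetric_operator "tuples (Suc m)" "cochain_space (Suc m)" "lap m" "dot (Suc m)"
    by (rule symmetric_operator_lap)
  obtain \<chi> where \<chi>: "\<chi> \<in> cochain_space (Suc m)" "lap m \<chi> = \<phi>"
    using coercive_imp_surjective[OF assms(1) assms(2) \<phi>(1)] by metis
  define \<beta> where "\<beta> = cob (Suc m) \<chi>"
  define \<alpha> where "\<alpha> = codiff \<beta>"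
  have \<beta>: "\<beta> \<in> cochain_space (m + 2)" and \<alpha>: "\<alpha> \<in> cochain_space (Suc m)"
    using \<chi> by (auto simp: \<alpha>_def \<beta>_def intro: cob_in_cochain_space codiff_in_cochain_space)
  have split: "\<phi> = (\<lambda>xs. cob m (codiff \<chi>) xs + 1 * \<alpha> xs)"
    using \<chi> laplacian_eq[OF \<chi>(1)] by (simp add: \<alpha>_def \<beta>_def)
  have "cob (Suc m) \<phi> = (\<lambda>xs. cob (Suc m) (cob m (codiff \<chi>)) xs + 1 * cob (Suc m) \<alpha> xs)"
    by (subst split, rule ext) (rule cob_linear)
  then have "cob (Suc m) \<alpha> = (\<lambda>_. 0)"
    by (simp add: \<phi>(2) cob_cob)
  then have "0 = dot (m + 2) (cob (Suc m) \<alpha>) \<beta>"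
    by (simp add: dot_def)
  also have "\<dots> = real (m + 2) * dot (Suc m) \<alpha> \<alpha>"
    using dot_cob[of \<beta> "Suc m" \<alpha>] \<beta> by (simp add: \<alpha>_def)
  finally have "\<alpha> = (\<lambda>_. 0)"
    using cochain_space_dot_eq_0[OF \<alpha>] by simp
  then have "\<phi> = cob m (codiff \<chi>)"
    using split by simp
  then show ?thesis using codiff_in_cochain_space[OF \<chi>(1)] by blast
qed

lemma trivial_reduced_cohomology:
  assumes "\<And>\<phi>. \<phi> \<in> cochain_space (Suc m) \<Longrightarrow> cob (Suc m) \<phi> = (\<lambda>_. 0) \<Longrightarrow>
    \<phi> \<in> cob m ` cochain_space m"
  shows "trivial_group (reduced_cohomology X (int m))"
proof -
  define K where "K = {\<phi> \<in> cochain_space (Suc m). cob (Suc m) \<phi> = (\<lambda>_. 0)}"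
  define G where "G = cochain_group X (int m)\<lparr>carrier := K\<rparr>"
  have "cob m ` cochain_space m = K"
    using assms cob_in_cochain_space by (auto simp: K_def cob_cob)
  moreover have "kernel (cochain_group X (int m)) (cochain_group X (int m + 1)) (coboundary X (int m)) = K"
    by (simp add: kernel_def cochain_group_def K_def cochain_space_def cob_def)
  ultimately have H: "reduced_cohomology X (int m) = G Mod K"
    by (simp add: reduced_cohomology_def G_def cochain_space_def cob_def)
  have combination: "(\<lambda>xs. f xs + t * g xs) \<in> K" if "f \<in> K" "g \<in> K" for f g t
    using that cochain_space_linear[of f "Suc m" g t] cob_linear[of "Suc m" f t g]
    by (auto simp: K_def)
  have zero: "(\<lambda>_. 0) \<in> K"
    by (simp add: K_def cochain_space_zero cob_eq fun_eq_iff)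
  have mult: "mult G = (\<lambda>\<phi> \<psi> xs. \<phi> xs + \<psi> xs)" and carrier: "carrier G = K"
    by (simp_all add: G_def cochain_group_def)
  have coset: "K #>\<^bsub>G\<^esub> a = K" if a: "a \<in> K" for a
  proof
    show "K #>\<^bsub>G\<^esub> a \<subseteq> K"
      using combination[OF _ a, of _ 1] by (auto simp: r_coset_def mult)
    show "K \<subseteq> K #>\<^bsub>G\<^esub> a"
    proof
      fix f assume "f \<in> K"
      then have "(\<lambda>xs. f xs + (- 1) * a xs) \<in> K" by (rule combination[OF _ a])
      moreover have "f = (\<lambda>xs. (f xs + (- 1) * a xs) + a xs)" by simp
      ultimately show "f \<in> K #>\<^bsub>G\<^esub> a"
        unfolding r_coset_def mult by blast
    qed
  qed
  have "K <#>\<^bsub>G\<^esub> K = K"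
  proof -
    have "K <#>\<^bsub>G\<^esub> K = (\<Union>a\<in>K. K #>\<^bsub>G\<^esub> a)"
      by (auto simp: set_mult_def r_coset_def)
    then show ?thesis using coset zero by auto
  qed
  moreover have "carrier (G Mod K) = {K}"
    using coset zero by (auto simp: carrier_FactGroup carrier)
  moreover from calculation have "group (G Mod K)"
    by (intro groupI) auto
  ultimately show ?thesis
    by (simp add: H trivial_group_def)
qed

end

theorem theorem1p3:
  fixes V :: "'a set" and X :: "'a set set" and n :: nat and d k :: int
  assumes "simplicial_complex V X"
    and "card V = n"
    and "missing_faces V X \<noteq> {}"
    and "max_missing_dim V X = d"
    and "k \<ge> d - 1"
    and "min_eigenvalue X (d - 1) > (1 - inverse (real (nat (k + 1) choose nat d))) * real n"
  shows "\<forall>j::int. d - 1 \<le> j \<and> j \<le> k \<longrightarrow> trivial_group (reduced_cohomology X j)"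
proof (intro allI impI)
  fix j :: int assume j: "d - 1 \<le> j \<and> j \<le> k"
  interpret finite_complex V X by standard (rule assms(1))
  have "finite (missing_faces V X)"
    using finite_V by (auto simp: missing_faces_def intro: finite_subset[of _ "Pow V"])
  then have dim_le: "simplex_dim \<sigma> \<le> d" if "\<sigma> \<in> missing_faces V X" for \<sigma>
    using that assms(4) by (auto simp: max_missing_dim_def intro!: Max_ge)
  obtain \<sigma> where \<sigma>: "\<sigma> \<in> missing_faces V X" using assms(3) by blast
  have fin: "finite \<sigma>" using \<sigma> finite_V by (auto simp: missing_faces_def intro: finite_subset)
  have "card \<sigma> \<noteq> 0" "card \<sigma> \<noteq> 1"
    using \<sigma> assms(1) fin by (auto simp: missing_faces_def simplicial_complex_def card_1_singleton_iff)
  then have "d \<ge> 1" using dim_le[OF \<sigma>] by (simp add: simplex_dim_def)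
  have "n > 0"
    using \<open>card \<sigma> \<noteq> 0\<close> \<sigma> finite_V assms(2) by (auto simp: missing_faces_def card_gt_0_iff)
  \<comment> \<open>A missing face has at least two vertices because all vertices of \<open>V\<close> are simplices. Therefore
    \<open>d \<ge> 1\<close>, and the dimensions \<open>d - 1\<close> and \<open>j\<close> are natural numbers.\<close>
  define D where "D = nat (d - 1)"
  define m where "m = nat j"
  have D: "d - 1 = int D" "nat d = Suc D" and m: "j = int m" "D \<le> m" "Suc m \<le> nat (k + 1)"
    using \<open>d \<ge> 1\<close> j by (auto simp: D_def m_def)
  define c where "c = real n - min_eigenvalue X (int D)"
  define b where "b = real (Suc m choose Suc D)"
  define B where "B = real (nat (k + 1) choose Suc D)"
  have "card \<sigma> \<le> Suc (Suc D)" if "\<sigma> \<in> missing_faces V X" for \<sigma>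
    using dim_le[OF that] D by (simp add: simplex_dim_def)
  moreover have "defect (Suc D) \<phi> \<le> c * real (Suc (Suc D)) * dot (Suc D) \<phi> \<phi>"
    if "\<phi> \<in> cochain_space (Suc D)" for \<phi>
    using min_eigenvalue_le_rayleigh[OF that] dot_lap_self[OF that] assms(2)
    by (simp add: c_def field_simps)
  ultimately have defect: "defect (Suc m) \<phi> \<le> c * b * real (m + 2) * dot (Suc m) \<phi> \<phi>"
    if "\<phi> \<in> cochain_space (Suc m)" for \<phi>
    using defect_bound_all_degrees[of "Suc D" c "Suc m" \<phi>] that m by (simp add: b_def)
  have "0 < b"
    unfolding b_def of_nat_0_less_iff by (rule zero_less_binomial) (use m in simp)
  have "b \<le> B"
  proof -
    have "(Suc m choose Suc D) \<le> (nat (k + 1) choose Suc D)"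
      by (rule lift_Suc_mono_le[of "\<lambda>i. i choose Suc D", OF _ m(3)]) simp
    then show ?thesis by (simp add: b_def B_def)
  qed
  have "c * B < real n"
    using assms(6) \<open>0 < b\<close> \<open>b \<le> B\<close> unfolding D c_def B_def[symmetric] by (simp add: field_simps)
  \<comment> \<open>Passing from \<open>B\<close> to the smaller \<open>b\<close> helps only if \<open>c\<close> is positive; otherwise the left-hand
    side is not positive at all.\<close>
  have "c * b < real n"
  proof (cases "c \<le> 0")
    case True
    then have "c * b \<le> 0" using \<open>0 < b\<close> by (simp add: mult_nonpos_nonneg)
    then show ?thesis using \<open>n > 0\<close> by simp
  next
    case False
    then have "c * b \<le> c * B" using \<open>b \<le> B\<close> by simp
    then show ?thesis using \<open>c * B < real n\<close> by simp
  qed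
  moreover have "(real n - c * b) * dot (Suc m) \<phi> \<phi> \<le> dot (Suc m) (lap m \<phi>) \<phi>"
    if "\<phi> \<in> cochain_space (Suc m)" for \<phi>
  proof -
    have "defect (Suc m) \<phi> / real (m + 2) \<le> c * b * dot (Suc m) \<phi> \<phi>"
      using defect[OF that] by (simp add: pos_divide_le_eq mult_ac)
    then show ?thesis
      using dot_lap_self[OF that] assms(2) by (simp add: left_diff_distrib)
  qed
  ultimately have "\<phi> \<in> cob m ` cochain_space m"
    if "\<phi> \<in> cochain_space (Suc m)" "cob (Suc m) \<phi> = (\<lambda>_. 0)" for \<phi>
    using cocycle_is_coboundary[of "real n - c * b" m \<phi>] that by simp
  then show "trivial_group (reduced_cohomology X j)"
    unfolding m(1) by (rule trivial_reduced_cohomology)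
qed

end
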